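(* Let $(\widehat{\Omega},\overline{\mathcal{M}})$, with $\widehat{\Omega}\subset\mathbb{R}^n$ and $\overline{\mathcal{M}}$ the Euclidean metric, and $(M,\mathcal{M})$ be Riemannian $n$-manifolds, and let $K_0\subset\widehat{\Omega}$ be a positively oriented linear $n$-simplex. Let $K=F(K_0)\subseteq M$ be a curved $n$-simplex that is unit with respect to $\mathcal{M}$ and $K_0$, i.e. $K$ is the image of $K_0$ by an orientation-preserving Riemannian isometry $F:\widehat{\Omega}\to M$. Then: \begin{enumerate} \item $K$ is positively oriented. In particular, if $K$ is a $\mathcal{P}^q$ simplex, it is valid everywhere. \item The inner angles and area of $K_0$, as well as the lengths and energies of its edges, are preserved in $K$ (quantities on $K_0$ being measured with $\overline{\mathcal{M}}$ and quantities on $K$ with $\mathcal{M}$). \item $K$ is a geodesic simplex in $(M,\mathcal{M})$. \item There is a rotation matrix $R$ such that the Jacobian matrix of $F_K$ writes, for any $\boldsymbol{\xi}\in\widehat{K}$, $$J_K(\boldsymbol{\xi})=\mathcal{M}^{-1/2}(F_K(\boldsymbol{\xi}))\,R\,J_{\widehat{K}\to K_0}.$$ \item Let $\eta_{K_0}(\boldsymbol{y})$ be the pointwise distortion of $K$ with respect to $K_0$, defined for $\boldsymbol{y}\in K_0$ by $$\eta_{K_0}(\boldsymbol{y})=\frac{1}{n}\,\frac{\operatorname{tr}\left(J_{K_0\to K}^T(\boldsymbol{y})\,[\mathcal{M}_{F(\boldsymbol{y})}]\,J_{K_0\to K}(\boldsymbol{y})\right)}{\left[\det\left(J_{K_0\to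 K}^T(\boldsymbol{y})\,[\mathcal{M}_{F(\boldsymbol{y})}]\,J_{K_0\to K}(\boldsymbol{y})\right)\right]^{1/n}}\geq 1.$$ Then $\eta_{K_0}(\boldsymbol{y})=1$ for all $\boldsymbol{y}\in K_0$. \end{enumerate}
   Context: Metrics. A Riemannian metric $\mathcal{M}=\mathcal{M}_{ij}\,dx^i dx^j$ on a smooth $n$-manifold $M$ with coordinates $x^i$ has symmetric positive-definite component matrix $[\mathcal{M}]=(\mathcal{M}_{ij})$. The Euclidean metric $\overline{\mathcal{M}}$ has component matrix $I$ in standard coordinates. If $[\mathcal{M}]=P\Lambda P^T$ is the diagonalized form of the component matrix (with $P$ orthogonal and $\Lambda$ diagonal), then $\mathcal{M}^{-1/2}=P\Lambda^{-1/2}P^T$; $\mathcal{M}^{-1/2}(\boldsymbol{x})$ is its value at the point $\boldsymbol{x}$. All Jacobian matrices of maps into $M$, and $[\mathcal{M}]$, are expressed in the same coordinates on $M$. A rotation matrix is an element of $\mathrm{SO}(n)$. Angles, lengths, energies. The angle $\theta\in[0,\pi]$ between tangent vectors $u,v$ at $\boldsymbol{p}$ with respect to $\mathcal{M}$ satisfies $\cos\theta=\langle u,v\rangle_{\mathcal{M}_{\boldsymbol{p}}}/(\|u\|_{\mathcal{M}_{\boldsymbol{p}}}\|v\|_{\mathcal{M}_{\boldsymbol{p}}})$. The length of a curve $\gamma:[a,b]\to M$ is $\ell_{\mathcal{M}}(\gamma)=\int_a^b\|\gamma'(t)\|_{\mathcal{M}}\,dt$, and its energy is $E_{\mathcal{M}}(\gamma)=\frac12\int_a^b\|\gamma'(t)\|_{\mathcal{M}}^2\,dt$.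 "Area" of a simplex means its $n$-dimensional Riemannian volume; in coordinates $|K|_{\mathcal{M}}=\int_{\widehat{K}}\sqrt{\det[\mathcal{M}]}\,\det J_K\,d\boldsymbol{\xi}$. Isometries. A Riemannian isometry $F:(M,\mathcal{M})\to(N,\mathcal{N})$ is a diffeomorphism with $F^*\mathcal{N}=\mathcal{M}$; in coordinates $[F^*\mathcal{N}]=J_F^T[\mathcal{N}]J_F$. Simplices. The reference simplex is $\widehat{K}=\{\boldsymbol{\xi}\in[0,1]^n : \sum_{i=1}^n\xi^i\le 1\}$. A linear simplex is a straight-sided simplex in $\mathbb{R}^n$; $F_{\widehat{K}\to K_0}$ is the affine map from $\widehat{K}$ onto $K_0$ and $J_{\widehat{K}\to K_0}$ its constant Jacobian matrix. For $K=F(K_0)$, the reference-to-physical transformation is $F_K=F_{\widehat{K}\to K}=F\circ F_{\widehat{K}\to K_0}$, with Jacobian matrix $J_K$ of entries $J_{K,ij}=\partial F_K^i/\partial\xi^j$, and $J_{K_0\to K}=J_F$ is the Jacobian matrix of $F$ on $K_0$. The edges of $K$ are the images under $F$ of the edges of $K_0$. A $\mathcal{P}^q$ simplex is a simplex $K=F_K(\widehat{K})$ whose reference-to-physical transformation $F_K$ is polynomial of degree $q$; it is called valid if it is positively oriented everywhere (i.e. $\det J_K>0$ on $\widehat{K}$). A geodesic simplex in $(M,\mathcal{M})$ is a simplex whose edges are geodesic curves of $(M,\mathcal{M})$.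
   Formalization: In item 4 the rotation matrix R may depend on the point ξ; a single R for all ξ is false in general, e.g. for F(z)=z² on Re z>0 with metric I/(4|w|), where R must be the rotation by arg z. *)

theory Defs
  imports "HOL-Analysis.Analysis"
begin

section \<open>Riemannian manifolds in coordinates\<close>

text \<open>
  An \<open>n\<close>-manifold with coordinates is represented by its coordinate domain, an open set of
  \<open>real^'n\<close>; a metric is represented by its field of component matrices. Functions are total, so
  their values outside the coordinate domain are irrelevant.
\<close>

text \<open>\<open>C\<^sup>k\<close> and \<open>C\<^sup>\<infinity>\<close> regularity by iterated directional derivatives; meant for open \<open>S\<close>.\<close>

primrec Ck_on :: "nat \<Rightarrow> 'a::real_normed_vector set \<Rightarrow> ('a \<Rightarrow> 'b::real_normed_vector) \<Rightarrow> bool" where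
  "Ck_on 0 S f \<longleftrightarrow> continuous_on S f"
| "Ck_on (Suc k) S f \<longleftrightarrow>
     (\<forall>x\<in>S. f differentiable (at x)) \<and> (\<forall>v. Ck_on k S (\<lambda>x. frechet_derivative f (at x) v))"

definition smooth_on :: "'a::real_normed_vector set \<Rightarrow> ('a \<Rightarrow> 'b::real_normed_vector) \<Rightarrow> bool" where
  "smooth_on S f \<longleftrightarrow> (\<forall>k. Ck_on k S f)"

type_synonym 'n metric_field = "real^'n \<Rightarrow> real^'n^'n"

definition riemannian_manifold :: "(real^'n) set \<Rightarrow> 'n::finite metric_field \<Rightarrow> bool" where
  "riemannian_manifold M G \<longleftrightarrow>
     open M \<and> smooth_on M G \<and>
     (\<forall>x\<in>M. transpose (G x) = G x \<and> (\<forall>u. u \<noteq> 0 \<longrightarrow> 0 < u \<bullet> (G x *v u)))"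

definition euclid_metric :: "'n::finite metric_field" where
  "euclid_metric x = mat 1"

text \<open>The next three operations take the component matrix \<open>A\<close> of the metric at a single point.\<close>

definition metric_inner :: "real^'n^'n \<Rightarrow> real^'n \<Rightarrow> real^'n::finite \<Rightarrow> real" where
  "metric_inner A u v = u \<bullet> (A *v v)"

definition metric_norm :: "real^'n^'n \<Rightarrow> real^'n::finite \<Rightarrow> real" where
  "metric_norm A u = sqrt (metric_inner A u u)"

definition metric_angle :: "real^'n^'n \<Rightarrow> real^'n \<Rightarrow> real^'n::finite \<Rightarrow> real" where
  "metric_angle A u v = arccos (metric_inner A u v / (metric_norm A u * metric_norm A v))"

definition diag_matrix :: "real^'n \<Rightarrow> real^'n^'n::finite" where
  "diag_matrix d = (\<chi> i j. if i = j then d $ i else 0)"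

text \<open>\<open>P \<Lambda>\<^sup>-\<^sup>1\<^sup>/\<^sup>2 P\<^sup>T\<close> for a diagonalization \<open>A = P \<Lambda> P\<^sup>T\<close>. For symmetric positive definite \<open>A\<close> a
  diagonalization exists and the result does not depend on the one chosen.\<close>

definition matrix_inv_sqrt :: "real^'n^'n \<Rightarrow> real^'n^'n::finite" where
  "matrix_inv_sqrt A = (SOME B. \<exists>P d. orthogonal_matrix P \<and>
     A = P ** diag_matrix d ** transpose P \<and>
     B = P ** diag_matrix (\<chi> i. 1 / sqrt (d $ i)) ** transpose P)"

definition curve_length :: "'n::finite metric_field \<Rightarrow> real \<Rightarrow> real \<Rightarrow> (real \<Rightarrow> real^'n) \<Rightarrow> real" where
  "curve_length G a b \<gamma> =
     integral {a..b} (\<lambda>t. metric_norm (G (\<gamma> t)) (vector_derivative \<gamma> (at t within {a..b})))"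

definition curve_energy :: "'n::finite metric_field \<Rightarrow> real \<Rightarrow> real \<Rightarrow> (real \<Rightarrow> real^'n) \<Rightarrow> real" where
  "curve_energy G a b \<gamma> =
     1 / 2 * integral {a..b} (\<lambda>t. (metric_norm (G (\<gamma> t)) (vector_derivative \<gamma> (at t within {a..b})))\<^sup>2)"

definition partial :: "'n::finite \<Rightarrow> (real^'n \<Rightarrow> real) \<Rightarrow> real^'n \<Rightarrow> real" where
  "partial i f x = frechet_derivative f (at x) (axis i 1)"

text \<open>Christoffel symbols of the second kind; \<open>k\<close> is the upper index.\<close>

definition christoffel :: "'n::finite metric_field \<Rightarrow> real^'n \<Rightarrow> 'n \<Rightarrow> 'n \<Rightarrow> 'n \<Rightarrow> real" where
  "christoffel G x k i j = 1 / 2 * (\<Sum>l\<in>UNIV. matrix_inv (G x) $ k $ l *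
     (partial i (\<lambda>y. G y $ j $ l) x + partial j (\<lambda>y. G y $ i $ l) x - partial l (\<lambda>y. G y $ i $ j) x))"

text \<open>Geodesics as solutions of the geodesic equation; \<open>\<gamma>'\<close> and \<open>\<gamma>''\<close> are the velocity and the
  acceleration, one-sided at the endpoints.\<close>

definition geodesic_on ::
  "(real^'n) set \<Rightarrow> 'n::finite metric_field \<Rightarrow> real \<Rightarrow> real \<Rightarrow> (real \<Rightarrow> real^'n) \<Rightarrow> bool" where
  "geodesic_on M G a b \<gamma> \<longleftrightarrow> (\<exists>\<gamma>' \<gamma>''. \<forall>t\<in>{a..b}.
     \<gamma> t \<in> M \<and>
     (\<gamma> has_vector_derivative \<gamma>' t) (at t within {a..b}) \<and>
     (\<gamma>' has_vector_derivative \<gamma>'' t) (at t within {a..b}) \<and>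
     (\<forall>k. \<gamma>'' t $ k
          + (\<Sum>i\<in>UNIV. \<Sum>j\<in>UNIV. christoffel G (\<gamma> t) k i j * \<gamma>' t $ i * \<gamma>' t $ j) = 0))"

definition diffeomorphism ::
  "(real^'n) set \<Rightarrow> (real^'n) set \<Rightarrow> (real^'n \<Rightarrow> real^'n::finite) \<Rightarrow> bool" where
  "diffeomorphism M N F \<longleftrightarrow>
     bij_betw F M N \<and> smooth_on M F \<and> smooth_on N (inv_into M F)"

definition pullback :: "(real^'n \<Rightarrow> real^'n) \<Rightarrow> 'n::finite metric_field \<Rightarrow> 'n metric_field" where
  "pullback F H x = transpose (jacobian F (at x)) ** H (F x) ** jacobian F (at x)"

definition riemannian_isometry ::
  "(real^'n) set \<Rightarrow> 'n metric_field \<Rightarrow> (real^'n) set \<Rightarrow> 'n::finite metric_field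
     \<Rightarrow> (real^'n \<Rightarrow> real^'n) \<Rightarrow> bool" where
  "riemannian_isometry M G N H F \<longleftrightarrow>
     diffeomorphism M N F \<and> (\<forall>x\<in>M. pullback F H x = G x)"

definition orientation_preserving :: "(real^'n) set \<Rightarrow> (real^'n \<Rightarrow> real^'n::finite) \<Rightarrow> bool" where
  "orientation_preserving M F \<longleftrightarrow> (\<forall>x\<in>M. 0 < det (jacobian F (at x)))"

section \<open>Simplices\<close>

text \<open>
  Vertices of an \<open>n\<close>-simplex are indexed by \<open>'n option\<close>: \<open>None\<close> stands for the vertex that is the
  image of the origin of the reference simplex, \<open>Some i\<close> for the image of the \<open>i\<close>-th unit vector.
  A (possibly curved) simplex is given by its reference-to-physical map \<open>\<Phi>\<close>, of which only the
  values on the reference simplex and the derivatives there matter.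
\<close>

definition ref_simplex :: "(real^'n::finite) set" where
  "ref_simplex = {\<xi>. (\<forall>i. \<xi> $ i \<in> {0..1}) \<and> (\<Sum>i\<in>UNIV. \<xi> $ i) \<le> 1}"

fun ref_vertex :: "'n::finite option \<Rightarrow> real^'n" where
  "ref_vertex None = 0"
| "ref_vertex (Some i) = axis i 1"

text \<open>Barycentric coordinates on the reference simplex and their (constant) Euclidean gradients.\<close>

fun bary :: "'n::finite option \<Rightarrow> real^'n \<Rightarrow> real" where
  "bary None \<xi> = 1 - (\<Sum>i\<in>UNIV. \<xi> $ i)"
| "bary (Some i) \<xi> = \<xi> $ i"

fun bary_grad :: "'n::finite option \<Rightarrow> real^'n" where
  "bary_grad None = (\<chi> i. - 1)"
| "bary_grad (Some i) = axis i 1"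

text \<open>The linear simplex with vertices \<open>p\<close>, and the affine map onto it from the reference simplex.\<close>

definition linear_simplex :: "('n::finite option \<Rightarrow> real^'n) \<Rightarrow> (real^'n) set" where
  "linear_simplex p = convex hull (range p)"

definition simplex_map :: "('n::finite option \<Rightarrow> real^'n) \<Rightarrow> real^'n \<Rightarrow> real^'n" where
  "simplex_map p \<xi> = p None + (\<Sum>i\<in>UNIV. \<xi> $ i *\<^sub>R (p (Some i) - p None))"

definition positively_oriented :: "(real^'n \<Rightarrow> real^'n::finite) \<Rightarrow> bool" where
  "positively_oriented \<Phi> \<longleftrightarrow> (\<forall>\<xi>\<in>ref_simplex. 0 < det (jacobian \<Phi> (at \<xi>)))"

text \<open>As usual for the space \<open>P\<^sup>q\<close>, degree \<open>q\<close> means total degree at most \<open>q\<close>; \<open>\<alpha>\<close> ranges over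
  exponent multi-indices.\<close>

definition Pq_simplex :: "nat \<Rightarrow> (real^'n \<Rightarrow> real^'n::finite) \<Rightarrow> bool" where
  "Pq_simplex q \<Phi> \<longleftrightarrow> (\<exists>c :: ('n \<Rightarrow> nat) \<Rightarrow> real^'n. \<forall>\<xi>\<in>ref_simplex.
     \<Phi> \<xi> = (\<Sum>\<alpha> | (\<Sum>i\<in>UNIV. \<alpha> i) \<le> q. (\<Prod>i\<in>UNIV. (\<xi> $ i) ^ \<alpha> i) *\<^sub>R c \<alpha>))"

definition valid_Pq_simplex :: "nat \<Rightarrow> (real^'n \<Rightarrow> real^'n::finite) \<Rightarrow> bool" where
  "valid_Pq_simplex q \<Phi> \<longleftrightarrow> Pq_simplex q \<Phi> \<and> positively_oriented \<Phi>"

text \<open>Edges are parametrized over \<open>{0..1}\<close> by the image of the straight reference edge.\<close>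

definition edge ::
  "(real^'n \<Rightarrow> real^'n::finite) \<Rightarrow> 'n option \<Rightarrow> 'n option \<Rightarrow> real \<Rightarrow> real^'n" where
  "edge \<Phi> i j t = \<Phi> ((1 - t) *\<^sub>R ref_vertex i + t *\<^sub>R ref_vertex j)"

text \<open>Inner angle at vertex \<open>i\<close> between the edges towards vertices \<open>j\<close> and \<open>k\<close>.\<close>

definition vertex_angle ::
  "'n::finite metric_field \<Rightarrow> (real^'n \<Rightarrow> real^'n) \<Rightarrow> 'n option \<Rightarrow> 'n option \<Rightarrow> 'n option \<Rightarrow> real" where
  "vertex_angle G \<Phi> i j k = metric_angle (G (\<Phi> (ref_vertex i)))
     (vector_derivative (edge \<Phi> i j) (at 0 within {0..1}))
     (vector_derivative (edge \<Phi> i k) (at 0 within {0..1}))"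

text \<open>The Riemannian gradient, at \<open>\<Phi> \<xi>\<close>, of the \<open>i\<close>-th barycentric coordinate transported by \<open>\<Phi>\<close>.
  On the facet opposite to vertex \<open>i\<close> it is an inward normal for the metric.\<close>

definition facet_normal ::
  "'n::finite metric_field \<Rightarrow> (real^'n \<Rightarrow> real^'n) \<Rightarrow> 'n option \<Rightarrow> real^'n \<Rightarrow> real^'n" where
  "facet_normal G \<Phi> i \<xi> =
     matrix_inv (G (\<Phi> \<xi>)) *v (transpose (matrix_inv (jacobian \<Phi> (at \<xi>))) *v bary_grad i)"

text \<open>Inner dihedral angle, at \<open>\<Phi> \<xi>\<close>, of the facets opposite to vertices \<open>i\<close> and \<open>j\<close>, where \<open>\<xi>\<close>
  lies on both reference facets. For \<open>n = 2\<close> this is the angle at the third vertex.\<close>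

definition dihedral_angle ::
  "'n::finite metric_field \<Rightarrow> (real^'n \<Rightarrow> real^'n) \<Rightarrow> 'n option \<Rightarrow> 'n option \<Rightarrow> real^'n \<Rightarrow> real" where
  "dihedral_angle G \<Phi> i j \<xi> =
     pi - metric_angle (G (\<Phi> \<xi>)) (facet_normal G \<Phi> i \<xi>) (facet_normal G \<Phi> j \<xi>)"

text \<open>The \<open>n\<close>-dimensional Riemannian volume, for a positively oriented simplex.\<close>

definition simplex_area :: "'n::finite metric_field \<Rightarrow> (real^'n \<Rightarrow> real^'n) \<Rightarrow> real" where
  "simplex_area G \<Phi> =
     integral ref_simplex (\<lambda>\<xi>. sqrt (det (G (\<Phi> \<xi>))) * det (jacobian \<Phi> (at \<xi>)))"

definition geodesic_simplex ::
  "(real^'n) set \<Rightarrow> 'n::finite metric_field \<Rightarrow> (real^'n \<Rightarrow> real^'n) \<Rightarrow> bool" where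
  "geodesic_simplex M G \<Phi> \<longleftrightarrow> (\<forall>i j. i \<noteq> j \<longrightarrow> geodesic_on M G 0 1 (edge \<Phi> i j))"

definition distortion :: "'n::finite metric_field \<Rightarrow> (real^'n \<Rightarrow> real^'n) \<Rightarrow> real^'n \<Rightarrow> real" where
  "distortion G F y =
     1 / real CARD('n) * (trace (pullback F G y) / root CARD('n) (det (pullback F G y)))"

lemma simplex_map_bary:
  fixes p :: "'n::finite option \<Rightarrow> real^'n"
  shows "simplex_map p \<xi> = (\<Sum>v\<in>UNIV. bary v \<xi> *\<^sub>R p v)"
proof -
  have "(\<Sum>v\<in>UNIV. bary v \<xi> *\<^sub>R p v) = bary None \<xi> *\<^sub>R p None + (\<Sum>i\<in>UNIV. \<xi> $ i *\<^sub>R p (Some i))"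
    by (simp add: UNIV_option_conv sum.reindex del: bary.simps(1))
  then show ?thesis
    by (simp add: simplex_map_def scaleR_diff_right sum_subtractf scaleR_sum_left[symmetric]
        scaleR_diff_left)
qed

lemma simplex_map_image:
  fixes p :: "'n::finite option \<Rightarrow> real^'n"
  shows "simplex_map p ` ref_simplex = linear_simplex p"
proof -
  have bary_nonneg: "0 \<le> bary v \<xi>" if "\<xi> \<in> ref_simplex" for v and \<xi> :: "real^'n"
    using that by (cases v) (auto simp: ref_simplex_def)
  have bary_sum: "(\<Sum>v\<in>UNIV. bary v \<xi>) = 1" for \<xi> :: "real^'n"
    by (simp add: UNIV_option_conv sum.reindex)
  show ?thesis
  proof (intro equalityI subsetI)
    fix x assume "x \<in> simplex_map p ` ref_simplex"
    then obtain \<xi> where \<xi>: "\<xi> \<in> ref_simplex" "x = (\<Sum>v\<in>UNIV. bary v \<xi> *\<^sub>R p v)"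
      by (auto simp: simplex_map_bary)
    show "x \<in> linear_simplex p"
      unfolding linear_simplex_def \<xi>(2)
      by (rule convex_sum) (auto simp: bary_sum bary_nonneg \<xi>(1) hull_inc)
  next
    fix x assume "x \<in> linear_simplex p"
    moreover have "convex (simplex_map p ` ref_simplex)"
    proof -
      have "convex (ref_simplex :: (real^'n) set)"
      proof (rule convexI)
        fix x y :: "real^'n" and u v :: real
        assume *: "x \<in> ref_simplex" "y \<in> ref_simplex" "0 \<le> u" "0 \<le> v" "u + v = 1"
        have "u * x $ i + v * y $ i \<le> 1" for i
          using * by (auto simp: ref_simplex_def intro!: convex_bound_le)
        moreover have "u * (\<Sum>i\<in>UNIV. x $ i) + v * (\<Sum>i\<in>UNIV. y $ i) \<le> 1"
          using * by (auto simp: ref_simplex_def intro!: convex_bound_le)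
        ultimately show "u *\<^sub>R x + v *\<^sub>R y \<in> ref_simplex"
          using * by (auto simp: ref_simplex_def sum.distrib sum_distrib_left)
      qed
      moreover have "linear (\<lambda>\<xi>::real^'n. \<Sum>i\<in>UNIV. \<xi> $ i *\<^sub>R (p (Some i) - p None))"
        by (rule linearI) (simp_all add: scaleR_add_left sum.distrib scaleR_sum_right)
      ultimately have "convex ((\<lambda>\<xi>::real^'n. \<Sum>i\<in>UNIV. \<xi> $ i *\<^sub>R (p (Some i) - p None)) ` ref_simplex)"
        by (rule convex_linear_image[rotated])
      then have "convex ((+) (p None) `
          (\<lambda>\<xi>::real^'n. \<Sum>i\<in>UNIV. \<xi> $ i *\<^sub>R (p (Some i) - p None)) ` ref_simplex)"
        by (rule convex_translation)
      then show ?thesis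
        by (simp add: image_image simplex_map_def[abs_def])
    qed
    moreover have "range p \<subseteq> simplex_map p ` ref_simplex"
    proof
      fix y assume "y \<in> range p"
      then obtain v where v: "y = p v" by auto
      have "simplex_map p (ref_vertex v) = p v"
        by (cases v) (simp_all add: simplex_map_def axis_def if_distrib[of "\<lambda>c. c *\<^sub>R _"] cong: if_cong)
      moreover have "ref_vertex v \<in> ref_simplex"
        by (cases v) (auto simp: ref_simplex_def axis_def)
      ultimately show "y \<in> simplex_map p ` ref_simplex" using v by (metis imageI)
    qed
    ultimately show "x \<in> simplex_map p ` ref_simplex"
      unfolding linear_simplex_def by (meson hull_minimal subsetD)
  qed
qed

lemma jacobian_simplex_map:
  fixes p :: "'n::finite option \<Rightarrow> real^'n"
  shows "jacobian (simplex_map p) (at \<xi>) = (\<chi> i j. p (Some j) $ i - p None $ i)"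
proof -
  have "(simplex_map p has_derivative (\<lambda>h. \<Sum>i\<in>UNIV. h $ i *\<^sub>R (p (Some i) - p None))) (at \<xi>)"
    unfolding simplex_map_def[abs_def] by (auto intro!: derivative_eq_intros bounded_linear_imp_has_derivative bounded_linear_vec_nth)
  then have "frechet_derivative (simplex_map p) (at \<xi>) =
      (\<lambda>h. \<Sum>i\<in>UNIV. h $ i *\<^sub>R (p (Some i) - p None))"
    by (rule frechet_derivative_at[symmetric])
  then show ?thesis
    by (simp add: jacobian_def matrix_def vec_eq_iff axis_def if_distrib[of "\<lambda>c. c * _"] cong: if_cong)
qed

end

theory Submission
  imports Defs
begin

text \<open>
  In coordinates the isometry condition reads \<open>J\<^sup>T A J = I\<close>, with \<open>J\<close> the Jacobian matrix of \<open>F\<close> at a point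
  of \<open>K\<^sub>0\<close> and \<open>A\<close> the matrix of the metric at its image. All claims but the geodesic one are pointwise
  consequences of this identity and \<open>det J > 0\<close>, combined with the chain rule, by which the Jacobian
  matrix of the composed map is \<open>J\<close> times the constant one of the affine map.

  \<^item> Since \<open>J\<close> carries the dot product to the inner product of the metric, it preserves the
    velocities of the edges in length and mutual angle, and the facet normals (Riemannian gradients
    of barycentric coordinates) correspond under \<open>J\<close> as well. Taking determinants gives
    \<open>\<surd>(det A) * det J = 1\<close>, so that the volume integrands agree (\<open>isometric_jacobian\<close>).

  \<^item> The matrix \<open>R = A\<^sup>1\<^sup>/\<^sup>2 J\<close> is orthogonal with positive determinant, hence a rotation
    (\<open>polar_rotation_of_isometric_jacobian\<close>). This relies on the spectral theorem for symmetric
    matrices (\<open>symmetric_matrix_diagonalization\<close>), obtained by maximizing the quadratic form.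

  \<^item> The pullback of the metric is the identity matrix, for which the arithmetic and geometric mean
    in the distortion coincide.

  That edges are geodesics is an infinitesimal statement of second order. Differentiating the
  isometry identity along constant vector fields, and using that second derivatives of \<open>F\<close> commute
  (\<open>mixed_directional_derivatives_eq\<close>), expresses the second derivative of \<open>F\<close> through the first
  derivatives of the metric in exactly the combination that defines the Christoffel symbols
  (\<open>geodesic_equation_of_flat_isometry\<close>).
\<close>

section \<open>Diagonalization of symmetric matrices\<close>

text \<open>
  A maximizer \<open>v\<close> of the quadratic form \<open>x \<bullet> f x\<close> on the unit sphere of \<open>S\<close> is an eigenvector, with
  the maximum \<open>c\<close> as eigenvalue. The residual \<open>u = f v - c v\<close> lies in \<open>S\<close> because \<open>S\<close> is invariant, so
  maximality applies to \<open>v + t u\<close>; the first-order term in \<open>t\<close> is a multiple of \<open>u \<bullet> u\<close> and must vanish.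
\<close>

lemma symmetric_eigenvector_in_invariant_subspace:
  fixes f :: "'a::euclidean_space \<Rightarrow> 'a"
  assumes f: "linear f" and sym: "\<And>x y. x \<bullet> f y = f x \<bullet> y"
    and S: "subspace S" "f ` S \<subseteq> S" "S \<noteq> {0}"
  obtains v c where "v \<in> S" "norm v = 1" "f v = c *\<^sub>R v"
proof -
  let ?K = "S \<inter> sphere 0 1"
  have "compact ?K"
    using S(1) by (simp add: closed_Int_compact closed_subspace)
  moreover have "?K \<noteq> {}"
  proof -
    obtain x where "x \<in> S" "x \<noteq> 0"
      using S(1,3) subspace_0 by blast
    then have "x /\<^sub>R norm x \<in> ?K"
      using S(1) by (simp add: subspace_scale)
    then show ?thesis by blast
  qed
  moreover have "continuous_on ?K (\<lambda>x. x \<bullet> f x)"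
    using f by (intro continuous_intros linear_continuous_on) (simp add: linear_conv_bounded_linear)
  ultimately obtain v where v: "v \<in> ?K" and vmax: "\<And>y. y \<in> ?K \<Longrightarrow> y \<bullet> f y \<le> v \<bullet> f v"
    using continuous_attains_sup by metis
  define c where "c = v \<bullet> f v"
  have vS: "v \<in> S" and v1: "v \<bullet> v = 1"
    using v by (auto simp: dot_square_norm)
  have quad_le: "x \<bullet> f x \<le> c * (x \<bullet> x)" if "x \<in> S" for x
  proof (cases "x = 0")
    case True
    then show ?thesis using linear_0[OF f] by simp
  next
    case False
    let ?y = "x /\<^sub>R norm x"
    have "?y \<in> ?K" using that S(1) False by (simp add: subspace_scale)
    from vmax[OF this] have "?y \<bullet> f ?y \<le> c" by (simp add: c_def)
    then have "(x \<bullet> f x) / (norm x * norm x) \<le> c"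
      by (simp add: linear_cmul[OF f] divide_simps)
    then show ?thesis
      using False by (simp add: divide_le_eq dot_square_norm power2_eq_square mult.commute)
  qed
  define u where "u = f v - c *\<^sub>R v"
  define k where "k = c * (u \<bullet> u) - u \<bullet> f u"
  have uS: "u \<in> S"
    unfolding u_def using S vS by (auto intro!: subspace_diff subspace_scale)
  have k0: "0 \<le> k" using quad_le[OF uS] by (simp add: k_def)
  have *: "2 * t * (u \<bullet> u) \<le> t\<^sup>2 * k" for t :: real
  proof -
    have "v + t *\<^sub>R u \<in> S" using S(1) vS uS by (auto intro!: subspace_add subspace_scale)
    from quad_le[OF this]
    have "v \<bullet> f v + t * (v \<bullet> f u) + t * (u \<bullet> f v) + t\<^sup>2 * (u \<bullet> f u)
        \<le> c * (v \<bullet> v + 2 * t * (u \<bullet> v) + t\<^sup>2 * (u \<bullet> u))"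
      by (simp add: linear_add[OF f] linear_cmul[OF f] algebra_simps inner_simps
          power2_eq_square inner_commute[of v u])
    moreover have "v \<bullet> f u = u \<bullet> f v" by (metis sym inner_commute)
    moreover have "u \<bullet> f v = u \<bullet> u + c * (u \<bullet> v)" by (simp add: u_def inner_simps)
    ultimately show ?thesis
      using v1 by (simp add: c_def[symmetric] k_def algebra_simps)
  qed
  have "u \<bullet> u = 0"
  proof (rule ccontr)
    assume "u \<bullet> u \<noteq> 0"
    then have pos: "0 < u \<bullet> u" by simp
    let ?t = "(u \<bullet> u) / (k + 1)"
    have t: "0 < ?t" using pos k0 by simp
    from *[of ?t] have "?t * (2 * (u \<bullet> u)) \<le> ?t * (?t * k)"
      by (simp only: power2_eq_square ac_simps)
    then have "2 * (u \<bullet> u) \<le> ?t * k" using t by (rule mult_left_le_imp_le)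
    also have "\<dots> \<le> u \<bullet> u" using pos k0 by (simp add: divide_simps)
    finally show False using pos by simp
  qed
  then have "f v = c *\<^sub>R v" by (simp add: u_def)
  then show ?thesis using that vS v by auto
qed

text \<open>
  The orthogonal complement of a set of eigenvectors is invariant under a self-adjoint map, so that
  the next eigenvector can be found in it.
\<close>

lemma orthonormal_eigenvectors_of_each_size:
  fixes f :: "'a::euclidean_space \<Rightarrow> 'a"
  assumes f: "linear f" and sym: "\<And>x y. x \<bullet> f y = f x \<bullet> y" and "k \<le> DIM('a)"
  shows "\<exists>B. finite B \<and> card B = k \<and> pairwise orthogonal B \<and> (\<forall>b\<in>B. norm b = 1 \<and> (\<exists>c. f b = c *\<^sub>R b))"
  using \<open>k \<le> DIM('a)\<close>
proof (induction k)
  case 0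
  show ?case by (rule exI[of _ "{}"]) simp
next
  case (Suc k)
  then obtain B where B: "finite B" "card B = k" "pairwise orthogonal B"
    and eig: "\<And>b. b \<in> B \<Longrightarrow> norm b = 1" "\<And>b. b \<in> B \<Longrightarrow> \<exists>c. f b = c *\<^sub>R b"
    by auto
  let ?S = "{x. \<forall>b\<in>B. b \<bullet> x = 0}"
  have "subspace ?S" by (auto simp: subspace_def inner_simps)
  moreover have "f ` ?S \<subseteq> ?S"
  proof clarsimp
    fix x b assume "\<forall>b\<in>B. b \<bullet> x = 0" "b \<in> B"
    moreover from this eig obtain c where "f b = c *\<^sub>R b" by blast
    ultimately show "b \<bullet> f x = 0" by (simp add: sym)
  qed
  moreover have "?S \<noteq> {0}"
  proof -
    have "dim (span B) < DIM('a)"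
      using B(1,2) Suc.prems dim_le_card'[of B] by simp
    then obtain x where "x \<noteq> 0" "\<And>y. y \<in> span B \<Longrightarrow> orthogonal x y"
      using orthogonal_to_subspace_exists[of B] by auto
    then have "x \<in> ?S" "x \<noteq> 0" by (auto simp: orthogonal_def span_base inner_commute)
    then show ?thesis by blast
  qed
  ultimately obtain v c where v: "v \<in> ?S" "norm v = 1" "f v = c *\<^sub>R v"
    by (rule symmetric_eigenvector_in_invariant_subspace[OF f sym])
  have "v \<notin> B" using v(1,2) by (auto simp: dot_square_norm)
  then have "card (insert v B) = Suc k" using B by simp
  moreover have "pairwise orthogonal (insert v B)"
    using B(3) v(1) by (auto simp: pairwise_insert orthogonal_def inner_commute)
  moreover have "\<forall>b\<in>insert v B. norm b = 1 \<and> (\<exists>c. f b = c *\<^sub>R b)"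
    using eig v(2,3) by blast
  moreover have "finite (insert v B)" using B(1) by simp
  ultimately show ?case by blast
qed

lemma matrix_mult_diag_matrix: "(A ** diag_matrix d) $ i $ j = A $ i $ j * d $ j"
  by (simp add: matrix_matrix_mult_def diag_matrix_def if_distrib[of "\<lambda>c. _ * c"] cong: if_cong)

text \<open>
  Orthonormal eigenvectors, taken as the columns of \<open>P\<close>. For the square root of a metric only the
  existence of a diagonalization matters, as the root is defined through an arbitrary one.
\<close>

theorem symmetric_matrix_diagonalization:
  fixes A :: "real^'n^'n::finite"
  assumes "transpose A = A"
  obtains P d where "orthogonal_matrix P" "A = P ** diag_matrix d ** transpose P"
proof -
  have sym: "x \<bullet> (A *v y) = (A *v x) \<bullet> y" for x y
    by (metis assms dot_lmul_matrix transpose_matrix_vector)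
  obtain B where B: "finite B" "card B = CARD('n)" "pairwise orthogonal B"
    and eig: "\<And>b. b \<in> B \<Longrightarrow> norm b = 1" "\<And>b. b \<in> B \<Longrightarrow> \<exists>c. A *v b = c *\<^sub>R b"
    using orthonormal_eigenvectors_of_each_size[OF matrix_vector_mul_linear sym, of "CARD('n)"]
    by auto
  obtain h :: "'n \<Rightarrow> real^'n" where h: "bij_betw h UNIV B"
    using finite_same_card_bij[of "UNIV :: 'n set" B] B by auto
  have hB: "h j \<in> B" for j using h by (auto simp: bij_betw_def)
  have "\<forall>j. \<exists>c. A *v h j = c *\<^sub>R h j" using eig(2) hB by blast
  then obtain e where e: "\<And>j. A *v h j = e j *\<^sub>R h j" by metis
  define P where "P = (\<chi> i j. h j $ i)"
  define d where "d = (\<chi> j. e j)"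
  have col: "column j P = h j" for j by (simp add: P_def column_def vec_eq_iff)
  have P: "orthogonal_matrix P"
    unfolding orthogonal_matrix_orthonormal_columns col
  proof (intro conjI allI impI)
    show "norm (h i) = 1" for i using eig(1) hB by blast
    show "orthogonal (h i) (h j)" if "i \<noteq> j" for i j
      using B(3) hB h that by (metis bij_betw_def injD pairwise_def)
  qed
  have "(A ** P) $ i $ j = (P ** diag_matrix d) $ i $ j" for i j
  proof -
    have "(A ** P) $ i $ j = (A *v h j) $ i"
      by (simp add: matrix_matrix_mult_def matrix_vector_mult_def P_def)
    then show ?thesis by (simp add: e matrix_mult_diag_matrix P_def d_def)
  qed
  then have AP: "A ** P = P ** diag_matrix d" by (simp add: vec_eq_iff)
  have "A = A ** (P ** transpose P)" using P by (simp add: orthogonal_matrix_def)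
  also have "\<dots> = P ** diag_matrix d ** transpose P" by (simp add: matrix_mul_assoc AP)
  finally have "A = P ** diag_matrix d ** transpose P" .
  with P show ?thesis by (rule that)
qed

section \<open>Symmetry of second derivatives\<close>

lemma has_vector_derivative_along_line:
  assumes "(f has_derivative f') (at (a + s *\<^sub>R u))"
  shows "((\<lambda>s. f (a + s *\<^sub>R u)) has_vector_derivative f' u) (at s within T)"
proof -
  have "((\<lambda>s. a + s *\<^sub>R u) has_vector_derivative u) (at s within T)"
    by (auto intro!: derivative_eq_intros simp: has_vector_derivative_def)
  from vector_derivative_diff_chain_within[OF this, of f f']
  show ?thesis using assms by (auto simp: o_def intro: has_derivative_at_withinI)
qed

text \<open>
  Two applications of the mean value theorem, first along \<open>u\<close>, then along \<open>v\<close>. The second difference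
  on the left is symmetric in \<open>u\<close> and \<open>v\<close>, while the expression on the right favours one order of
  differentiation.
\<close>

lemma second_difference_mean_value:
  fixes f :: "'a::real_normed_vector \<Rightarrow> real"
  assumes "0 < h"
    and box: "\<And>s t. \<lbrakk>0 \<le> s; s \<le> h; 0 \<le> t; t \<le> h\<rbrakk> \<Longrightarrow> x + s *\<^sub>R u + t *\<^sub>R v \<in> S"
    and f': "\<And>y. y \<in> S \<Longrightarrow> (f has_derivative f' y) (at y)"
    and A: "\<And>y. y \<in> S \<Longrightarrow> ((\<lambda>z. f' z u) has_derivative A y) (at y)"
  obtains s t where "0 < s" "s < h" "0 < t" "t < h"
    "f (x + h *\<^sub>R u + h *\<^sub>R v) - f (x + h *\<^sub>R u) - f (x + h *\<^sub>R v) + f x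
      = h * h * A (x + s *\<^sub>R u + t *\<^sub>R v) v"
proof -
  let ?g = "\<lambda>s. f ((x + h *\<^sub>R v) + s *\<^sub>R u) - f (x + s *\<^sub>R u)"
  have "(?g has_real_derivative f' ((x + h *\<^sub>R v) + s *\<^sub>R u) u - f' (x + s *\<^sub>R u) u) (at s)"
    if "0 \<le> s" "s \<le> h" for s
  proof -
    have "x + h *\<^sub>R v + s *\<^sub>R u \<in> S" "x + s *\<^sub>R u \<in> S"
      using box[of s h] box[of s 0] that \<open>0 < h\<close> by (simp_all add: add_ac)
    then show ?thesis
      unfolding has_real_derivative_iff_has_vector_derivative
      by (intro has_vector_derivative_diff has_vector_derivative_along_line f')
  qed
  from MVT2[OF \<open>0 < h\<close> this] obtain s where s: "0 < s" "s < h"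
    and g: "?g h - ?g 0 = (h - 0) * (f' ((x + h *\<^sub>R v) + s *\<^sub>R u) u - f' (x + s *\<^sub>R u) u)"
    by blast
  let ?k = "\<lambda>t. f' ((x + s *\<^sub>R u) + t *\<^sub>R v) u"
  have "(?k has_real_derivative A ((x + s *\<^sub>R u) + t *\<^sub>R v) v) (at t)" if "0 \<le> t" "t \<le> h" for t
    unfolding has_real_derivative_iff_has_vector_derivative
    using box[of s t] s that
    by (intro has_vector_derivative_along_line[where f = "\<lambda>z. f' z u"] A) simp_all
  from MVT2[OF \<open>0 < h\<close> this] obtain t where t: "0 < t" "t < h"
    and k: "?k h - ?k 0 = (h - 0) * A ((x + s *\<^sub>R u) + t *\<^sub>R v) v"
    by blast
  have "?g h - ?g 0 = h * (?k h - ?k 0)"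
    using g by (simp add: add_ac)
  also have "\<dots> = h * h * A (x + s *\<^sub>R u + t *\<^sub>R v) v" using k by simp
  finally have "f (x + h *\<^sub>R u + h *\<^sub>R v) - f (x + h *\<^sub>R u) - f (x + h *\<^sub>R v) + f x
      = h * h * A (x + s *\<^sub>R u + t *\<^sub>R v) v"
    by (simp add: add_ac)
  with s t show ?thesis by (rule that)
qed

text \<open>
  The second difference over a small parallelogram is a value of either mixed derivative near \<open>x\<close>,
  times the same factor \<open>h * h\<close>. If the mixed derivatives differed at \<open>x\<close>, continuity would keep their
  values near \<open>x\<close> apart.
\<close>

lemma mixed_directional_derivatives_eq_real:
  fixes f :: "'a::real_normed_vector \<Rightarrow> real"
  assumes S: "open S" "x \<in> S"
    and f': "\<And>y. y \<in> S \<Longrightarrow> (f has_derivative f' y) (at y)"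
    and A: "\<And>y. y \<in> S \<Longrightarrow> ((\<lambda>z. f' z u) has_derivative A y) (at y)"
    and B: "\<And>y. y \<in> S \<Longrightarrow> ((\<lambda>z. f' z v) has_derivative B y) (at y)"
    and cA: "continuous_on S (\<lambda>y. A y v)" and cB: "continuous_on S (\<lambda>y. B y u)"
  shows "A x v = B x u"
proof (rule ccontr)
  assume ne: "A x v \<noteq> B x u"
  define e where "e = \<bar>A x v - B x u\<bar> / 2"
  have e: "0 < e" using ne by (simp add: e_def)
  have "continuous (at x) (\<lambda>y. A y v)" "continuous (at x) (\<lambda>y. B y u)"
    using cA cB S by (auto simp: continuous_on_eq_continuous_at)
  then have "((\<lambda>y. A y v) \<longlongrightarrow> A x v) (nhds x)" "((\<lambda>y. B y u) \<longlongrightarrow> B x u) (nhds x)"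
    unfolding isCont_def
    using tendsto_at_iff_tendsto_nhds[of "\<lambda>y. A y v" x] tendsto_at_iff_tendsto_nhds[of "\<lambda>y. B y u" x]
    by simp_all
  from this[THEN tendstoD, OF e]
  have "\<forall>\<^sub>F y in nhds x. dist (A y v) (A x v) < e" "\<forall>\<^sub>F y in nhds x. dist (B y u) (B x u) < e" .
  moreover have "\<forall>\<^sub>F y in nhds x. y \<in> S" using S by (rule eventually_nhds_in_open)
  ultimately have "\<forall>\<^sub>F y in nhds x. y \<in> S \<and> dist (A y v) (A x v) < e \<and> dist (B y u) (B x u) < e"
    by eventually_elim simp
  then obtain d where d: "0 < d"
    and near: "\<And>y. dist y x < d \<Longrightarrow> y \<in> S \<and> dist (A y v) (A x v) < e \<and> dist (B y u) (B x u) < e"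
    unfolding eventually_nhds_metric by auto
  \<comment> \<open>\<open>h\<close> makes the parallelogram fit into the ball of radius \<open>d\<close>; the summand \<open>1\<close> covers \<open>u = v = 0\<close>.\<close>
  define h where "h = d / (norm u + norm v + 1)"
  have uv: "0 < norm u + norm v + 1" by (simp add: add_nonneg_pos)
  have h: "0 < h" using d uv by (simp add: h_def)
  have box: "dist (x + s *\<^sub>R u + t *\<^sub>R v) x < d" if "0 \<le> s" "s \<le> h" "0 \<le> t" "t \<le> h" for s t
  proof -
    have "dist (x + s *\<^sub>R u + t *\<^sub>R v) x \<le> s * norm u + t * norm v"
      using that norm_triangle_ineq[of "s *\<^sub>R u" "t *\<^sub>R v"] by (simp add: dist_norm add.assoc)
    also have "\<dots> \<le> h * norm u + h * norm v"
      using that by (intro add_mono mult_right_mono) auto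
    also have "\<dots> < h * (norm u + norm v + 1)"
      using h by (simp add: algebra_simps)
    also have "\<dots> = d" using uv by (simp add: h_def)
    finally show ?thesis .
  qed
  have boxS: "x + s *\<^sub>R u + t *\<^sub>R v \<in> S" if "0 \<le> s" "s \<le> h" "0 \<le> t" "t \<le> h" for s t
    using box[OF that] near by blast
  obtain s t where st: "0 < s" "s < h" "0 < t" "t < h"
    and dA: "f (x + h *\<^sub>R u + h *\<^sub>R v) - f (x + h *\<^sub>R u) - f (x + h *\<^sub>R v) + f x
      = h * h * A (x + s *\<^sub>R u + t *\<^sub>R v) v"
    using second_difference_mean_value[of h x u v S f f' A, OF h boxS f' A] by blast
  have boxS': "x + s *\<^sub>R v + t *\<^sub>R u \<in> S" if "0 \<le> s" "s \<le> h" "0 \<le> t" "t \<le> h" for s t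
    using boxS[of t s] that by (simp add: add_ac)
  obtain s' t' where st': "0 < s'" "s' < h" "0 < t'" "t' < h"
    and dB: "f (x + h *\<^sub>R v + h *\<^sub>R u) - f (x + h *\<^sub>R v) - f (x + h *\<^sub>R u) + f x
      = h * h * B (x + s' *\<^sub>R v + t' *\<^sub>R u) u"
    using second_difference_mean_value[of h x v u S f f' B, OF h boxS' f' B] by blast
  let ?y = "x + s *\<^sub>R u + t *\<^sub>R v" and ?z = "x + t' *\<^sub>R u + s' *\<^sub>R v"
  have swap: "x + a *\<^sub>R v + b *\<^sub>R u = x + b *\<^sub>R u + a *\<^sub>R v" for a b
    by (simp add: add_ac)
  have "h * h * A ?y v = h * h * B ?z u"
    using dA dB unfolding swap by linarith
  then have "A ?y v = B ?z u" using h by simp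
  moreover have "dist (A ?y v) (A x v) < e" "dist (B ?z u) (B x u) < e"
    using near box st st' by (meson less_imp_le)+
  ultimately show False
    using ne unfolding e_def dist_real_def by argo
qed

theorem mixed_directional_derivatives_eq:
  fixes f :: "'a::real_normed_vector \<Rightarrow> 'b::euclidean_space"
  assumes "open S" "x \<in> S" and C2: "Ck_on (Suc (Suc 0)) S f"
  shows "frechet_derivative (\<lambda>y. frechet_derivative f (at y) u) (at x) v =
    frechet_derivative (\<lambda>y. frechet_derivative f (at y) v) (at x) u"
proof (rule euclidean_eqI)
  fix b :: 'b
  let ?D = "\<lambda>w y. frechet_derivative (\<lambda>y. frechet_derivative f (at y) w) (at y)"
  have 1: "((\<lambda>y. f y \<bullet> b) has_derivative (\<lambda>w. frechet_derivative f (at y) w \<bullet> b)) (at y)"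
    if "y \<in> S" for y
    using C2 that by (intro has_derivative_inner_left) (simp add: frechet_derivative_works)
  have 2: "((\<lambda>y. frechet_derivative f (at y) w \<bullet> b) has_derivative (\<lambda>w'. ?D w y w' \<bullet> b)) (at y)"
    if "y \<in> S" for y w
    using C2 that by (intro has_derivative_inner_left) (simp add: frechet_derivative_works)
  have 3: "continuous_on S (\<lambda>y. ?D w y w' \<bullet> b)" for w w'
    using C2 by (intro continuous_intros) simp
  show "?D u x v \<bullet> b = ?D v x u \<bullet> b"
    using mixed_directional_derivatives_eq_real[OF assms(1,2) 1 2 2 3 3, where u=u and v=v]
    by simp
qed

section \<open>Isometric Jacobian matrices\<close>

lemma matrix_inv_eqI:
  fixes A B :: "real^'n^'n"
  assumes "A ** B = mat 1"
  shows "matrix_inv A = B"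
proof -
  have BA: "B ** A = mat 1" using assms by (simp add: matrix_left_right_inverse)
  have "A ** matrix_inv A = mat 1"
    unfolding matrix_inv_def by (rule someI2[of _ B]) (use assms BA in auto)
  then have "B ** (A ** matrix_inv A) = B" by simp
  then show ?thesis by (simp add: matrix_mul_assoc BA)
qed

text \<open>
  Supplies the product rule for \<open>G (F y) *v w y\<close>.
\<close>

lemma bounded_bilinear_matrix_vector_mult:
  "bounded_bilinear ((*v) :: real^'n::finite^'m::finite \<Rightarrow> real^'n \<Rightarrow> real^'m)"
  unfolding bilinear_conv_bounded_bilinear[symmetric] bilinear_def
  by (auto intro!: linearI simp: matrix_vector_right_distrib matrix_vector_mult_add_rdistrib
      matrix_vector_mult_scaleR scaleR_matrix_vector_assoc)

lemma inner_matrix_vector_left: "((A :: real^'n^'m) *v u) \<bullet> v = u \<bullet> (transpose A *v v)"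
  by (metis dot_lmul_matrix inner_commute transpose_matrix_vector)

text \<open>
  The pointwise content of an isometry from Euclidean space: \<open>J\<^sup>T A J = I\<close> makes \<open>J\<^sup>T A\<close> the inverse of \<open>J\<close>,
  hence \<open>J J\<^sup>T\<close> the inverse of \<open>A\<close>, and says that \<open>J\<close> carries the dot product to the inner product
  of \<open>A\<close>.
\<close>

lemma isometric_jacobian:
  fixes J A :: "real^'n^'n"
  assumes "transpose J ** A ** J = mat 1"
  shows isometric_jacobian_inverse: "J ** (transpose J ** A) = mat 1"
    and isometric_jacobian_gram: "A ** (J ** transpose J) = mat 1"
    and isometric_jacobian_inner: "metric_inner A (J *v u) (J *v v) = u \<bullet> v"
    and isometric_jacobian_det: "det A * (det J)\<^sup>2 = 1"
proof -
  show 1: "J ** (transpose J ** A) = mat 1"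
    using assms by (simp add: matrix_left_right_inverse)
  then have "(J ** transpose J) ** A = mat 1" by (simp add: matrix_mul_assoc)
  then show "A ** (J ** transpose J) = mat 1" by (simp add: matrix_left_right_inverse)
  show "metric_inner A (J *v u) (J *v v) = u \<bullet> v"
    unfolding metric_inner_def inner_matrix_vector_left
    by (simp add: matrix_vector_mul_assoc matrix_mul_assoc assms)
  have "det (transpose J ** A ** J) = 1" by (simp add: assms)
  then show "det A * (det J)\<^sup>2 = 1"
    by (simp add: det_mul det_transpose power2_eq_square ac_simps)
qed

section \<open>The geodesic equation for images of straight lines\<close>

lemma linear_basis_expansion:
  assumes "linear (L :: real^'n::finite \<Rightarrow> 'b::real_vector)"
  shows "L a = (\<Sum>i\<in>UNIV. a $ i *\<^sub>R L (axis i 1))"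
proof -
  have "a = (\<Sum>i\<in>UNIV. a $ i *\<^sub>R axis i 1)"
    by (metis (no_types, lifting) basis_expansion scalar_mult_eq_scaleR sum.cong)
  then have "L a = L (\<Sum>i\<in>UNIV. a $ i *\<^sub>R axis i 1)" by simp
  then show ?thesis by (simp add: linear_sum[OF assms] linear_cmul[OF assms])
qed

text \<open>
  The first two of the three derivatives in a Christoffel symbol contribute equally once they are
  contracted twice with \<open>a\<close>. What remains involves the metric only through its derivative in the
  direction \<open>a\<close> and through the gradient of \<open>a \<bullet> (G *v a)\<close> with \<open>a\<close> held constant.
\<close>

lemma christoffel_quadratic_form:
  fixes G :: "'n::finite metric_field"
  assumes DG: "(G has_derivative DG) (at z)"
  shows "(\<Sum>i\<in>UNIV. \<Sum>j\<in>UNIV. christoffel G z k i j * a $ i * a $ j) =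
    (matrix_inv (G z) *v (\<chi> l. (a v* DG a) $ l - 1 / 2 * (a \<bullet> (DG (axis l 1) *v a)))) $ k"
proof -
  define P where "P i j l = DG (axis i 1) $ j $ l" for i j l
  define X where "X l = (\<Sum>i\<in>UNIV. \<Sum>j\<in>UNIV. P i j l * a $ i * a $ j)" for l
  define Y where "Y l = (\<Sum>i\<in>UNIV. \<Sum>j\<in>UNIV. P l i j * a $ i * a $ j)" for l
  let ?I = "matrix_inv (G z)"
  have lin: "linear DG" using DG by (rule has_derivative_linear)
  have partial: "partial i (\<lambda>y. G y $ j $ l) z = P i j l" for i j l
  proof -
    have "((\<lambda>y. G y $ j $ l) has_derivative (\<lambda>h. DG h $ j $ l)) (at z)"
      by (intro bounded_linear.has_derivative[OF bounded_linear_vec_nth] DG)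
    from fun_cong[OF frechet_derivative_at[OF this], of "axis i 1"] show ?thesis
      by (simp add: partial_def P_def)
  qed
  have X: "(a v* DG a) $ l = X l" for l
  proof -
    have "(a v* DG a) $ l = (\<Sum>j\<in>UNIV. \<Sum>i\<in>UNIV. P i j l * a $ i * a $ j)"
      unfolding vector_matrix_mult_def
      by (subst linear_basis_expansion[OF lin, of a])
        (simp add: P_def sum_distrib_left sum_distrib_right ac_simps)
    then show ?thesis unfolding X_def by (subst sum.swap)
  qed
  have X': "X l = (\<Sum>i\<in>UNIV. \<Sum>j\<in>UNIV. P j i l * a $ i * a $ j)" for l
    unfolding X_def by (subst sum.swap) (simp add: ac_simps)
  have Y: "a \<bullet> (DG (axis l 1) *v a) = Y l" for l
    by (simp add: Y_def P_def inner_vec_def matrix_vector_mult_def sum_distrib_left ac_simps)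
  have sym: "(\<Sum>i\<in>UNIV. \<Sum>j\<in>UNIV. (P i j l + P j i l - P l i j) * a $ i * a $ j) = 2 * X l - Y l" for l
  proof -
    have "(\<Sum>i\<in>UNIV. \<Sum>j\<in>UNIV. (P i j l + P j i l - P l i j) * a $ i * a $ j)
        = X l + (\<Sum>i\<in>UNIV. \<Sum>j\<in>UNIV. P j i l * a $ i * a $ j) - Y l"
      by (simp add: X_def Y_def algebra_simps sum.distrib sum_subtractf)
    then show ?thesis by (simp flip: X')
  qed
  have "(\<Sum>i\<in>UNIV. \<Sum>j\<in>UNIV. christoffel G z k i j * a $ i * a $ j)
      = (\<Sum>i\<in>UNIV. \<Sum>j\<in>UNIV. \<Sum>l\<in>UNIV. ?I $ k $ l * (1 / 2) * ((P i j l + P j i l - P l i j) * a $ i * a $ j))"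
    by (simp add: christoffel_def partial sum_distrib_left sum_distrib_right ac_simps)
  also have "\<dots> = (\<Sum>i\<in>UNIV. \<Sum>l\<in>UNIV. \<Sum>j\<in>UNIV. ?I $ k $ l * (1 / 2) * ((P i j l + P j i l - P l i j) * a $ i * a $ j))"
    by (rule sum.cong[OF refl]) (rule sum.swap)
  also have "\<dots> = (\<Sum>l\<in>UNIV. \<Sum>i\<in>UNIV. \<Sum>j\<in>UNIV. ?I $ k $ l * (1 / 2) * ((P i j l + P j i l - P l i j) * a $ i * a $ j))"
    by (rule sum.swap)
  also have "\<dots> = (\<Sum>l\<in>UNIV. ?I $ k $ l * (1 / 2) * (2 * X l - Y l))"
    by (simp only: sym flip: sum_distrib_left)
  also have "\<dots> = (\<Sum>l\<in>UNIV. ?I $ k $ l * (X l - 1 / 2 * Y l))"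
    by (intro sum.cong refl) (simp add: field_simps)
  finally show ?thesis
    by (subst matrix_vector_mult_def) (simp add: X Y)
qed

lemma frechet_derivative_jacobian:
  fixes F :: "real^'n::finite \<Rightarrow> real^'m::finite"
  assumes "F differentiable (at x)"
  shows "frechet_derivative F (at x) h = jacobian F (at x) *v h"
proof -
  have "(F has_derivative (\<lambda>h. jacobian F (at x) *v h)) (at x)"
    using assms by (simp add: jacobian_works)
  from fun_cong[OF frechet_derivative_at[OF this]] show ?thesis by simp
qed

text \<open>
  Write \<open>Du\<close> for the
  image of a constant vector \<open>u\<close> under the derivative of \<open>F\<close>, and \<open>A\<close> for the metric at \<open>F x\<close>. Since
  \<open>Du \<bullet> (A *v Dv)\<close> has the constant value \<open>u \<bullet> v\<close>, its derivative in every direction \<open>h\<close> vanishes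
  (\<open>diff_iso\<close>). With \<open>(u, v, h) = (w, v, w)\<close> this expresses \<open>Dv \<bullet> (A *v D2 w w)\<close> through the derivative of
  the metric and the mixed term \<open>Dw \<bullet> (A *v D2 v w)\<close>; with \<open>(u, v, h) = (w, w, v)\<close> it determines that mixed
  term, by the symmetry of second derivatives. The result is the geodesic equation for the image
  of a line with velocity \<open>w\<close>, tested against \<open>Dv\<close>, and the vectors \<open>Dv\<close> exhaust the space.
\<close>

lemma geodesic_equation_of_flat_isometry:
  fixes F :: "real^'n::finite \<Rightarrow> real^'n" and G :: "'n metric_field"
  assumes \<Omega>: "open \<Omega>" "x \<in> \<Omega>" and C2: "Ck_on (Suc (Suc 0)) \<Omega> F"
    and G: "G differentiable (at (F x))" and G_sym: "transpose (G (F x)) = G (F x)"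
    and iso: "\<And>y. y \<in> \<Omega> \<Longrightarrow> pullback F G y = mat 1"
  shows "frechet_derivative (\<lambda>y. frechet_derivative F (at y) w) (at x) w $ k
    + (\<Sum>i\<in>UNIV. \<Sum>j\<in>UNIV. christoffel G (F x) k i j
        * frechet_derivative F (at x) w $ i * frechet_derivative F (at x) w $ j) = 0"
proof -
  let ?F' = "\<lambda>y. frechet_derivative F (at y)"
  define D2 where "D2 u = frechet_derivative (\<lambda>y. ?F' y u) (at x)" for u
  define DG where "DG = frechet_derivative G (at (F x))"
  define A where "A = G (F x)"
  define J where "J = jacobian F (at x)"
  note mv = bounded_bilinear_matrix_vector_mult
  have DG: "(G has_derivative DG) (at (F x))"
    using G by (simp add: DG_def frechet_derivative_works)
  have linG: "linear DG" using DG by (rule has_derivative_linear)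
  have F': "(F has_derivative ?F' y) (at y)" if "y \<in> \<Omega>" for y
    using C2 that by (simp add: frechet_derivative_works)
  have F'J: "?F' y u = jacobian F (at y) *v u" if "y \<in> \<Omega>" for y u
    using C2 that by (intro frechet_derivative_jacobian) simp
  have D2: "((\<lambda>y. ?F' y u) has_derivative D2 u) (at x)" for u
    using C2 \<Omega>(2) by (simp add: D2_def frechet_derivative_works)
  have commute: "D2 u v = D2 v u" for u v
    unfolding D2_def using \<Omega> C2 by (rule mixed_directional_derivatives_eq)
  have A_sym: "u \<bullet> (A *v v) = v \<bullet> (A *v u)" for u v
    using G_sym by (metis A_def inner_matrix_vector_left inner_commute)
  have J: "transpose J ** A ** J = mat 1"
    using iso[OF \<Omega>(2)] by (simp add: pullback_def J_def A_def)
  have inner_const: "?F' y u \<bullet> (G (F y) *v ?F' y v) = u \<bullet> v" if "y \<in> \<Omega>" for y u v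
    using isometric_jacobian_inner[of "jacobian F (at y)" "G (F y)"] iso[OF that]
    by (simp add: F'J[OF that] pullback_def metric_inner_def)
  have diff_iso: "D2 u h \<bullet> (A *v ?F' x v) + ?F' x u \<bullet> (DG (?F' x h) *v ?F' x v)
      + ?F' x u \<bullet> (A *v D2 v h) = 0" for u v h
  proof -
    have GF: "((\<lambda>y. G (F y)) has_derivative (\<lambda>h. DG (?F' x h))) (at x)"
      using diff_chain_at[OF F'[OF \<Omega>(2)] DG] by (simp add: o_def)
    have "((\<lambda>y. ?F' y u \<bullet> (G (F y) *v ?F' y v)) has_derivative
        (\<lambda>h. ?F' x u \<bullet> (A *v D2 v h + DG (?F' x h) *v ?F' x v) + D2 u h \<bullet> (A *v ?F' x v))) (at x)"
      unfolding A_def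
      by (intro has_derivative_inner D2 bounded_bilinear.FDERIV[OF mv] GF)
    moreover have "((\<lambda>y. ?F' y u \<bullet> (G (F y) *v ?F' y v)) has_derivative (\<lambda>h. 0)) (at x)"
      by (rule has_derivative_transform_within_open[OF has_derivative_const \<Omega>])
        (simp add: inner_const)
    ultimately have "(\<lambda>h. ?F' x u \<bullet> (A *v D2 v h + DG (?F' x h) *v ?F' x v)
        + D2 u h \<bullet> (A *v ?F' x v)) = (\<lambda>h. 0)"
      by (rule has_derivative_unique)
    from fun_cong[OF this, of h] show ?thesis by (simp add: inner_add_right)
  qed
  define a where "a = ?F' x w"
  \<comment> \<open>\<open>c\<close> is the Christoffel term of the equation with its index lowered by the metric.\<close>
  define c where "c = (\<chi> l. (a v* DG a) $ l - 1 / 2 * (a \<bullet> (DG (axis l 1) *v a)))"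
  have c: "b \<bullet> c = a \<bullet> (DG a *v b) - 1 / 2 * (a \<bullet> (DG b *v a))" for b
  proof -
    have "linear (\<lambda>b. a \<bullet> (DG b *v a))"
      by (rule linearI) (simp_all add: linear_add[OF linG] linear_cmul[OF linG]
          matrix_vector_mult_add_rdistrib inner_add_right flip: scaleR_matrix_vector_assoc)
    from linear_basis_expansion[OF this, of b]
    have "a \<bullet> (DG b *v a) = (\<Sum>l\<in>UNIV. b $ l * (a \<bullet> (DG (axis l 1) *v a)))"
      by simp
    moreover have "a \<bullet> (DG a *v b) = b \<bullet> (a v* DG a)"
      by (metis dot_lmul_matrix inner_commute)
    then have "a \<bullet> (DG a *v b) = (\<Sum>l\<in>UNIV. b $ l * (a v* DG a) $ l)"
      by (simp add: inner_vec_def)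
    ultimately show ?thesis
      by (simp add: c_def inner_vec_def[of b] algebra_simps sum_subtractf sum_distrib_left)
  qed
  have zero: "?F' x v \<bullet> (A *v D2 w w + c) = 0" for v
  proof -
    have "D2 w w \<bullet> (A *v ?F' x v) + a \<bullet> (DG a *v ?F' x v) + a \<bullet> (A *v D2 v w) = 0"
      using diff_iso[of w w v] by (simp add: a_def)
    moreover have "D2 w v \<bullet> (A *v a) + a \<bullet> (DG (?F' x v) *v a) + a \<bullet> (A *v D2 w v) = 0"
      using diff_iso[of w v w] by (simp add: a_def)
    moreover have "D2 w v \<bullet> (A *v a) = a \<bullet> (A *v D2 w v)" by (rule A_sym)
    moreover have "D2 w w \<bullet> (A *v ?F' x v) = ?F' x v \<bullet> (A *v D2 w w)" by (rule A_sym)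
    moreover have "?F' x v \<bullet> c = a \<bullet> (DG a *v ?F' x v) - 1 / 2 * (a \<bullet> (DG (?F' x v) *v a))"
      by (rule c)
    ultimately show ?thesis using commute[of v w] by (simp add: inner_add_right)
  qed
  have r: "A *v D2 w w + c = 0"
  proof -
    let ?r = "A *v D2 w w + c"
    have "?F' x ((transpose J ** A) *v ?r) = ?r"
      using isometric_jacobian_inverse[OF J]
      by (simp add: F'J[OF \<Omega>(2)] matrix_vector_mul_assoc flip: J_def)
    with zero have "?r \<bullet> ?r = 0" by metis
    then show ?thesis by simp
  qed
  define B where "B = matrix_inv A"
  have "B ** A = mat 1"
    unfolding B_def using isometric_jacobian_gram[OF J]
    by (metis matrix_inv_eqI matrix_left_right_inverse)
  then have "D2 w w + B *v c = B *v (A *v D2 w w + c)"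
    by (simp add: matrix_vector_right_distrib matrix_vector_mul_assoc)
  also have "\<dots> = 0" by (simp add: r)
  finally have "(D2 w w + B *v c) $ k = 0" by simp
  then show ?thesis
    using christoffel_quadratic_form[OF DG, of k a]
    by (simp add: D2_def a_def c_def B_def A_def)
qed

section \<open>The Jacobian matrix as the inverse root of the metric times a rotation\<close>

lemma jacobian_compose:
  fixes f :: "real^'n::finite \<Rightarrow> real^'m::finite" and g :: "real^'m \<Rightarrow> real^'k::finite"
  assumes "f differentiable (at x)" "g differentiable (at (f x))"
  shows "jacobian (g \<circ> f) (at x) = jacobian g (at (f x)) ** jacobian f (at x)"
  unfolding jacobian_def frechet_derivative_compose[OF assms]
  using assms by (intro matrix_compose linear_frechet_derivative)

lemma det_diag_matrix: "det (diag_matrix d) = (\<Prod>i\<in>UNIV. d $ i)"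
  by (subst det_diagonal) (simp_all add: diag_matrix_def)

lemma diag_matrix_mult: "diag_matrix d ** diag_matrix e = diag_matrix (\<chi> i. d $ i * e $ i)"
  by (simp add: vec_eq_iff matrix_mult_diag_matrix) (simp add: diag_matrix_def)

lemma transpose_diag_matrix: "transpose (diag_matrix d) = diag_matrix d"
  by (auto simp: vec_eq_iff transpose_def diag_matrix_def)

text \<open>
  Conjugation by an orthogonal matrix is multiplicative, which reduces products of matrix functions of
  a symmetric matrix to products of diagonal matrices.
\<close>

lemma orthogonal_conjugate_mult:
  fixes P :: "real^'n::finite^'n"
  assumes "orthogonal_matrix P"
  shows "(P ** A ** transpose P) ** (P ** B ** transpose P) = P ** (A ** B) ** transpose P"
proof -
  have "(P ** A ** transpose P) ** (P ** B ** transpose P)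
      = P ** A ** (transpose P ** P) ** B ** transpose P"
    by (simp only: matrix_mul_assoc)
  moreover have "transpose P ** P = mat 1" using assms by (simp add: orthogonal_matrix_def)
  ultimately show ?thesis by (simp add: matrix_mul_assoc)
qed

text \<open>
  The rotation is \<open>R = A\<^sup>1\<^sup>/\<^sup>2 J\<close>: from \<open>J\<^sup>T A J = I\<close> it follows that \<open>R\<^sup>T R = I\<close>, and \<open>det R\<close> is positive as a product of
  positive determinants.
\<close>

lemma polar_rotation_of_isometric_jacobian:
  fixes A J :: "real^'n::finite^'n"
  assumes A_sym: "transpose A = A" and A_pos: "\<And>u. u \<noteq> 0 \<Longrightarrow> 0 < u \<bullet> (A *v u)"
    and J: "transpose J ** A ** J = mat 1" and J_pos: "0 < det J"
  obtains R where "rotation_matrix R" "J = matrix_inv_sqrt A ** R"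
proof -
  have "\<exists>B P d. orthogonal_matrix P \<and> A = P ** diag_matrix d ** transpose P \<and>
     B = P ** diag_matrix (\<chi> i. 1 / sqrt (d $ i)) ** transpose P"
    using symmetric_matrix_diagonalization[OF A_sym] by metis
  \<comment> \<open>The root \<open>Q\<close> has to be formed with the same diagonalization that the choice operator in
    \<open>matrix_inv_sqrt\<close> selected.\<close>
  from someI_ex[OF this] obtain P d where P: "orthogonal_matrix P"
    and A: "A = P ** diag_matrix d ** transpose P"
    and N: "matrix_inv_sqrt A = P ** diag_matrix (\<chi> i. 1 / sqrt (d $ i)) ** transpose P"
    unfolding matrix_inv_sqrt_def[symmetric] by blast
  have d: "0 < d $ i" for i
  proof -
    let ?u = "P *v axis i 1"
    have at_axis: "transpose P *v ?u = axis i 1"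
      using P by (simp add: orthogonal_matrix_def matrix_vector_mul_assoc)
    then have "?u \<noteq> 0" by (metis axis_eq_0_iff matrix_vector_mult_0_right zero_neq_one)
    then have "0 < ?u \<bullet> (A *v ?u)" by (rule A_pos)
    also have "?u \<bullet> (A *v ?u) = ?u \<bullet> (P *v (diag_matrix d *v (transpose P *v ?u)))"
      by (simp only: A matrix_vector_mul_assoc matrix_mul_assoc)
    also have "\<dots> = (transpose P *v ?u) \<bullet> (diag_matrix d *v (transpose P *v ?u))"
      by (simp only: inner_matrix_vector_left[of "transpose P"] transpose_transpose)
    also have "\<dots> = axis i 1 \<bullet> (diag_matrix d *v axis i 1)" by (simp only: at_axis)
    also have "\<dots> = d $ i"
      by (simp add: inner_axis' matrix_vector_mult_basis column_def diag_matrix_def)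
    finally show ?thesis .
  qed
  define Q where "Q = P ** diag_matrix (\<chi> i. sqrt (d $ i)) ** transpose P"
  have one: "diag_matrix (\<chi> i. 1) = mat 1" by (simp add: diag_matrix_def mat_def vec_eq_iff)
  have NQ: "matrix_inv_sqrt A ** Q = mat 1"
    using d P by (simp add: N Q_def orthogonal_conjugate_mult[OF P] diag_matrix_mult one
        less_imp_neq[symmetric] orthogonal_matrix_def)
  have QQ: "Q ** Q = A"
    using d by (simp add: A Q_def orthogonal_conjugate_mult[OF P] diag_matrix_mult less_imp_le)
  have Q_sym: "transpose Q = Q"
    by (simp add: Q_def matrix_transpose_mul transpose_diag_matrix matrix_mul_assoc)
  have Q_pos: "0 < det Q"
  proof -
    have "det P * det (transpose P) = 1"
      using P by (metis det_I det_mul orthogonal_matrix_def)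
    then have "det Q = (\<Prod>i\<in>UNIV. sqrt (d $ i))"
      by (simp add: Q_def det_mul det_diag_matrix)
    then show ?thesis using d by (simp add: prod_pos)
  qed
  have "transpose (Q ** J) ** (Q ** J) = transpose J ** (Q ** Q) ** J"
    by (simp add: matrix_transpose_mul Q_sym matrix_mul_assoc)
  then have orth: "orthogonal_matrix (Q ** J)"
    by (simp add: orthogonal_matrix QQ J)
  moreover have "0 < det (Q ** J)" using Q_pos J_pos by (simp add: det_mul)
  ultimately have "rotation_matrix (Q ** J)"
    using det_orthogonal_matrix[OF orth] by (auto simp: rotation_matrix_def)
  moreover have "J = matrix_inv_sqrt A ** (Q ** J)"
    by (simp add: matrix_mul_assoc NQ)
  ultimately show ?thesis by (rule that)
qed

section \<open>Unit simplices\<close>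

lemma isometric_jacobian_metric_norm:
  fixes J A :: "real^'n::finite^'n"
  assumes "transpose J ** A ** J = mat 1"
  shows "metric_norm A (J *v u) = metric_norm (mat 1) u"
  using isometric_jacobian_inner[OF assms] by (simp add: metric_norm_def metric_inner_def)

lemma isometric_jacobian_metric_angle:
  fixes J A :: "real^'n::finite^'n"
  assumes "transpose J ** A ** J = mat 1"
  shows "metric_angle A (J *v u) (J *v v) = metric_angle (mat 1) u v"
  using isometric_jacobian_inner[OF assms]
  by (simp add: metric_angle_def metric_norm_def metric_inner_def)

lemma edge_simplex_map: "edge (simplex_map p) i j t = p i + t *\<^sub>R (p j - p i)"
proof -
  have eq: "simplex_map p ((1 - t) *\<^sub>R x + t *\<^sub>R y) =
      (1 - t) *\<^sub>R simplex_map p x + t *\<^sub>R simplex_map p y" for x y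
    by (simp add: simplex_map_def algebra_simps sum.distrib scaleR_sum_right sum_subtractf)
  have "simplex_map p (ref_vertex v) = p v" for v
    by (cases v) (simp_all add: simplex_map_def axis_def if_distrib[of "\<lambda>c. c *\<^sub>R _"] cong: if_cong)
  then show ?thesis unfolding edge_def eq by (simp add: algebra_simps)
qed

lemma edge_compose: "edge (F \<circ> \<Phi>) i j t = F (edge \<Phi> i j t)"
  by (simp add: edge_def)

lemma edge_simplex_map_in_linear_simplex:
  assumes "t \<in> {0..1}"
  shows "edge (simplex_map p) i j t \<in> linear_simplex p"
proof -
  have "(1 - t) *\<^sub>R p i + t *\<^sub>R p j \<in> linear_simplex p"
    unfolding linear_simplex_def using assms
    by (intro convexD_alt[OF convex_convex_hull]) (auto intro: hull_inc)
  then show ?thesis by (simp add: edge_simplex_map algebra_simps)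
qed

lemma simplex_map_differentiable: "simplex_map p differentiable (at \<xi>)"
proof -
  have "(simplex_map p has_derivative (\<lambda>h. \<Sum>i\<in>UNIV. h $ i *\<^sub>R (p (Some i) - p None))) (at \<xi>)"
    unfolding simplex_map_def[abs_def]
    by (auto intro!: derivative_eq_intros bounded_linear_imp_has_derivative bounded_linear_vec_nth)
  then show ?thesis by (rule differentiableI)
qed

text \<open>
  A linear simplex in a flat domain together with an isometry of that domain; the curved simplex is
  given by the map \<open>F \<circ> simplex_map p\<close>. Through \<open>J_isometric\<close> the pointwise lemmas on isometric Jacobian
  matrices apply at every point of the linear simplex.
\<close>

locale isometric_simplex =
  fixes \<Omega> M :: "(real^'n::finite) set"
    and G :: "'n metric_field"
    and F :: "real^'n \<Rightarrow> real^'n"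
    and p :: "'n option \<Rightarrow> real^'n"
  assumes \<Omega>: "riemannian_manifold \<Omega> euclid_metric"
    and M: "riemannian_manifold M G"
    and oriented: "positively_oriented (simplex_map p)"
    and subset: "linear_simplex p \<subseteq> \<Omega>"
    and isometry: "riemannian_isometry \<Omega> euclid_metric M G F"
    and orientation: "orientation_preserving \<Omega> F"
begin

abbreviation J :: "real^'n \<Rightarrow> real^'n^'n" where "J y \<equiv> jacobian F (at y)"

lemma open_\<Omega>: "open \<Omega>"
  using \<Omega> by (simp add: riemannian_manifold_def)

lemma F_in_M: "y \<in> \<Omega> \<Longrightarrow> F y \<in> M"
  using isometry by (auto simp: riemannian_isometry_def diffeomorphism_def bij_betw_def)

lemma pullback_eq: "y \<in> \<Omega> \<Longrightarrow> pullback F G y = mat 1"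
  using isometry by (simp add: riemannian_isometry_def euclid_metric_def)

lemma J_isometric: "y \<in> \<Omega> \<Longrightarrow> transpose (J y) ** G (F y) ** J y = mat 1"
  using pullback_eq by (simp add: pullback_def)

lemma det_J_pos: "y \<in> \<Omega> \<Longrightarrow> 0 < det (J y)"
  using orientation by (simp add: orientation_preserving_def)

lemma F_Ck: "Ck_on k \<Omega> F"
  using isometry by (simp add: riemannian_isometry_def diffeomorphism_def smooth_on_def)

lemma F_differentiable: "y \<in> \<Omega> \<Longrightarrow> F differentiable (at y)"
  using F_Ck[of "Suc 0"] by simp

lemma F_has_derivative: "y \<in> \<Omega> \<Longrightarrow> (F has_derivative (\<lambda>h. J y *v h)) (at y)"
  using F_differentiable jacobian_works by blast

lemma G_sym: "z \<in> M \<Longrightarrow> transpose (G z) = G z"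
  and G_pos: "z \<in> M \<Longrightarrow> u \<noteq> 0 \<Longrightarrow> 0 < u \<bullet> (G z *v u)"
  using M by (simp_all add: riemannian_manifold_def)

lemma G_differentiable: "z \<in> M \<Longrightarrow> G differentiable (at z)"
proof -
  assume "z \<in> M"
  have "Ck_on (Suc 0) M G" using M by (simp add: riemannian_manifold_def smooth_on_def)
  with \<open>z \<in> M\<close> show ?thesis by simp
qed

lemma simplex_map_in_\<Omega>: "\<xi> \<in> ref_simplex \<Longrightarrow> simplex_map p \<xi> \<in> \<Omega>"
  using simplex_map_image[of p] subset by blast

lemma edge_in_\<Omega>: "t \<in> {0..1} \<Longrightarrow> edge (simplex_map p) i j t \<in> \<Omega>"
  using edge_simplex_map_in_linear_simplex subset by blast

lemma jacobian_physical:
  assumes "\<xi> \<in> ref_simplex"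
  shows "jacobian (F \<circ> simplex_map p) (at \<xi>) =
    J (simplex_map p \<xi>) ** jacobian (simplex_map p) (at \<xi>)"
  using assms by (intro jacobian_compose simplex_map_differentiable F_differentiable simplex_map_in_\<Omega>)

lemma edge_velocity:
  assumes "t \<in> {0..1}"
  shows "(edge (F \<circ> simplex_map p) i j has_vector_derivative
      J (edge (simplex_map p) i j t) *v (p j - p i)) (at t within T)"
    and "(edge (simplex_map p) i j has_vector_derivative p j - p i) (at t within T)"
proof -
  show "(edge (F \<circ> simplex_map p) i j has_vector_derivative
      J (edge (simplex_map p) i j t) *v (p j - p i)) (at t within T)"
    using has_vector_derivative_along_line[OF F_has_derivative, of "p i" t "p j - p i" T]
      edge_in_\<Omega>[OF assms, of i j]
    by (simp add: edge_simplex_map edge_compose[abs_def])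
  show "(edge (simplex_map p) i j has_vector_derivative p j - p i) (at t within T)"
    unfolding edge_simplex_map[abs_def]
    by (auto intro!: derivative_eq_intros simp: has_vector_derivative_def)
qed

lemma edge_vector_derivative:
  assumes "t \<in> {0..1}"
  shows "vector_derivative (edge (F \<circ> simplex_map p) i j) (at t within {0..1}) =
      J (edge (simplex_map p) i j t) *v (p j - p i)"
    and "vector_derivative (edge (simplex_map p) i j) (at t within {0..1}) = p j - p i"
  using assms edge_velocity[OF assms]
  by (auto intro!: vector_derivative_within_closed_interval)

lemma edge_speed:
  assumes "t \<in> {0..1}"
  shows "metric_norm (G (edge (F \<circ> simplex_map p) i j t))
      (vector_derivative (edge (F \<circ> simplex_map p) i j) (at t within {0..1})) =
    metric_norm (euclid_metric (edge (simplex_map p) i j t))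
      (vector_derivative (edge (simplex_map p) i j) (at t within {0..1}))"
  using isometric_jacobian_metric_norm[OF J_isometric[OF edge_in_\<Omega>[OF assms]]]
  by (simp add: edge_vector_derivative[OF assms] edge_compose euclid_metric_def)

lemma curve_length_eq:
  "curve_length G 0 1 (edge (F \<circ> simplex_map p) i j) =
    curve_length euclid_metric 0 1 (edge (simplex_map p) i j)"
  unfolding curve_length_def by (intro integral_cong edge_speed)

lemma curve_energy_eq:
  "curve_energy G 0 1 (edge (F \<circ> simplex_map p) i j) =
    curve_energy euclid_metric 0 1 (edge (simplex_map p) i j)"
  unfolding curve_energy_def
  by (intro arg_cong[where f = "\<lambda>e. 1 / 2 * e"] integral_cong) (simp only: edge_speed)

lemma vertex_angle_eq:
  "vertex_angle G (F \<circ> simplex_map p) i j k = vertex_angle euclid_metric (simplex_map p) i j k"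
proof -
  have 0: "(0::real) \<in> {0..1}" by simp
  have start: "edge \<Phi> i j 0 = \<Phi> (ref_vertex i)" for \<Phi> :: "real^'n \<Rightarrow> real^'n" and j
    by (simp add: edge_def)
  show ?thesis
    unfolding vertex_angle_def edge_vector_derivative[OF 0] euclid_metric_def
    using isometric_jacobian_metric_angle[OF J_isometric[OF edge_in_\<Omega>[OF 0]], of i j]
    by (simp add: start)
qed

lemma positively_oriented_physical: "positively_oriented (F \<circ> simplex_map p)"
  using oriented det_J_pos simplex_map_in_\<Omega>
  by (simp add: positively_oriented_def jacobian_physical det_mul)

text \<open>
  Gradients are natural under isometries: the inverse transposed Jacobian of \<open>F\<close>, which acts on
  covectors, and the inverse metric combine to \<open>J J\<^sup>T (J\<^sup>T)\<^sup>-\<^sup>1 = J\<close>.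
\<close>

lemma facet_normal_eq:
  assumes "\<xi> \<in> ref_simplex"
  shows "facet_normal G (F \<circ> simplex_map p) i \<xi> =
    J (simplex_map p \<xi>) *v facet_normal euclid_metric (simplex_map p) i \<xi>"
proof -
  let ?y = "simplex_map p \<xi>" and ?S = "jacobian (simplex_map p) (at \<xi>)"
  let ?J = "J ?y" and ?A = "G (F ?y)"
  have y: "?y \<in> \<Omega>" by (rule simplex_map_in_\<Omega>[OF assms])
  note iso = J_isometric[OF y]
  have "det ?S \<noteq> 0" using oriented assms by (force simp: positively_oriented_def)
  then obtain S' where S': "?S ** S' = mat 1"
    by (metis invertible_det_nz invertible_def)
  have "(?J ** ?S) ** (S' ** (transpose ?J ** ?A)) = ?J ** (?S ** S') ** (transpose ?J ** ?A)"
    by (simp only: matrix_mul_assoc)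
  also have "\<dots> = mat 1"
    using isometric_jacobian_inverse[OF iso] by (simp add: S')
  finally have inv: "matrix_inv (?J ** ?S) = S' ** (transpose ?J ** ?A)"
    by (rule matrix_inv_eqI)
  have inv_mat_1: "matrix_inv (mat 1 :: real^'n^'n) = mat 1" by (rule matrix_inv_eqI) simp
  have "facet_normal G (F \<circ> simplex_map p) i \<xi> =
      (?J ** transpose ?J ** (?A ** ?J ** transpose S')) *v bary_grad i"
    using isometric_jacobian_gram[OF iso, THEN matrix_inv_eqI] G_sym[OF F_in_M[OF y]]
    by (simp add: facet_normal_def jacobian_physical[OF assms] inv matrix_transpose_mul
        matrix_vector_mul_assoc matrix_mul_assoc)
  also have "?J ** transpose ?J ** (?A ** ?J ** transpose S')
      = ?J ** (transpose ?J ** ?A ** ?J) ** transpose S'"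
    by (simp only: matrix_mul_assoc)
  also have "\<dots> = ?J ** transpose S'" by (simp add: iso)
  finally show ?thesis
    unfolding facet_normal_def[of euclid_metric] euclid_metric_def matrix_inv_eqI[OF S'] inv_mat_1
    by (simp add: o_def matrix_vector_mul_assoc del: transpose_matrix_vector)
qed

lemma dihedral_angle_eq:
  assumes "\<xi> \<in> ref_simplex"
  shows "dihedral_angle G (F \<circ> simplex_map p) i j \<xi> =
    dihedral_angle euclid_metric (simplex_map p) i j \<xi>"
  unfolding dihedral_angle_def facet_normal_eq[OF assms]
  using isometric_jacobian_metric_angle[OF J_isometric[OF simplex_map_in_\<Omega>[OF assms]]]
  by (simp add: euclid_metric_def)

lemma simplex_area_eq:
  "simplex_area G (F \<circ> simplex_map p) = simplex_area euclid_metric (simplex_map p)"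
  unfolding simplex_area_def
proof (rule integral_cong)
  fix \<xi> :: "real^'n" assume \<xi>: "\<xi> \<in> ref_simplex"
  let ?y = "simplex_map p \<xi>"
  have y: "?y \<in> \<Omega>" by (rule simplex_map_in_\<Omega>[OF \<xi>])
  have "sqrt (det (G (F ?y))) * det (J ?y) = sqrt (det (G (F ?y)) * (det (J ?y))\<^sup>2)"
    using det_J_pos[OF y] by (simp add: real_sqrt_mult)
  also have "\<dots> = 1" by (simp add: isometric_jacobian_det[OF J_isometric[OF y]])
  finally show "sqrt (det (G ((F \<circ> simplex_map p) \<xi>))) * det (jacobian (F \<circ> simplex_map p) (at \<xi>)) =
      sqrt (det (euclid_metric ?y)) * det (jacobian (simplex_map p) (at \<xi>))"
    by (simp add: jacobian_physical[OF \<xi>] det_mul euclid_metric_def flip: mult.assoc)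
qed

text \<open>
  An edge is the image of a segment with constant velocity \<open>p j - p i\<close>, so its acceleration is the
  second derivative of \<open>F\<close> in that direction.
\<close>

lemma geodesic_simplex_physical: "geodesic_simplex M G (F \<circ> simplex_map p)"
  unfolding geodesic_simplex_def geodesic_on_def
proof (intro allI impI exI ballI conjI)
  fix i j :: "'n option" and t :: real and k :: 'n
  assume t: "t \<in> {0..1}"
  let ?y = "\<lambda>t. edge (simplex_map p) i j t" and ?w = "p j - p i"
  let ?D = "\<lambda>x. frechet_derivative F (at x) ?w"
  have y: "?y t \<in> \<Omega>" by (rule edge_in_\<Omega>[OF t])
  show "edge (F \<circ> simplex_map p) i j t \<in> M"
    by (simp add: edge_compose F_in_M y)
  show "(edge (F \<circ> simplex_map p) i j has_vector_derivative ?D (?y t)) (at t within {0..1})"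
    using edge_velocity(1)[OF t] by (simp add: frechet_derivative_jacobian F_differentiable y)
  have "(?D has_derivative frechet_derivative ?D (at (?y t))) (at (?y t))"
    using F_Ck[of "Suc (Suc 0)"] y by (simp add: frechet_derivative_works)
  then show "((\<lambda>t. ?D (?y t)) has_vector_derivative frechet_derivative ?D (at (?y t)) ?w)
      (at t within {0..1})"
    unfolding edge_simplex_map by (rule has_vector_derivative_along_line)
  show "frechet_derivative ?D (at (?y t)) ?w $ k + (\<Sum>i'\<in>UNIV. \<Sum>j'\<in>UNIV.
      christoffel G (edge (F \<circ> simplex_map p) i j t) k i' j' * ?D (?y t) $ i' * ?D (?y t) $ j') = 0"
    unfolding edge_compose
    using open_\<Omega> y F_Ck G_differentiable[OF F_in_M[OF y]] G_sym[OF F_in_M[OF y]] pullback_eq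
    by (rule geodesic_equation_of_flat_isometry)
qed

lemma jacobian_eq_inv_sqrt_rotation:
  assumes "\<xi> \<in> ref_simplex"
  shows "\<exists>R. rotation_matrix R \<and> jacobian (F \<circ> simplex_map p) (at \<xi>) =
    matrix_inv_sqrt (G ((F \<circ> simplex_map p) \<xi>)) ** R ** jacobian (simplex_map p) (at \<xi>)"
proof -
  have y: "simplex_map p \<xi> \<in> \<Omega>" by (rule simplex_map_in_\<Omega>[OF assms])
  note z = F_in_M[OF y]
  obtain R where "rotation_matrix R"
    "J (simplex_map p \<xi>) = matrix_inv_sqrt (G (F (simplex_map p \<xi>))) ** R"
    using polar_rotation_of_isometric_jacobian[OF G_sym[OF z] G_pos[OF z] J_isometric[OF y] det_J_pos[OF y]]
    by blast
  then show ?thesis by (auto simp: jacobian_physical[OF assms])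
qed

lemma distortion_eq_1:
  assumes "y \<in> linear_simplex p"
  shows "distortion G F y = 1"
  using pullback_eq[of y] assms subset by (auto simp: distortion_def trace_I)

end

theorem proposition5p2:
  fixes \<Omega> M :: "(real^'n::finite) set"
    and G :: "'n metric_field"
    and F :: "real^'n \<Rightarrow> real^'n"
    and p :: "'n option \<Rightarrow> real^'n"
  assumes "riemannian_manifold \<Omega> euclid_metric"
    and "riemannian_manifold M G"
    and "positively_oriented (simplex_map p)"
    and "linear_simplex p \<subseteq> \<Omega>"
    and "riemannian_isometry \<Omega> euclid_metric M G F"
    and "orientation_preserving \<Omega> F"
  shows
    "(positively_oriented (F \<circ> simplex_map p) \<and>
      (\<forall>q. Pq_simplex q (F \<circ> simplex_map p) \<longrightarrow> valid_Pq_simplex q (F \<circ> simplex_map p)))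
   \<and>
     ((\<forall>i j k. distinct [i, j, k] \<longrightarrow>
        vertex_angle G (F \<circ> simplex_map p) i j k =
          vertex_angle euclid_metric (simplex_map p) i j k) \<and>
      (\<forall>i j. i \<noteq> j \<longrightarrow> (\<forall>\<xi>\<in>ref_simplex. bary i \<xi> = 0 \<and> bary j \<xi> = 0 \<longrightarrow>
        dihedral_angle G (F \<circ> simplex_map p) i j \<xi> =
          dihedral_angle euclid_metric (simplex_map p) i j \<xi>)) \<and>
      simplex_area G (F \<circ> simplex_map p) = simplex_area euclid_metric (simplex_map p) \<and>
      (\<forall>i j. i \<noteq> j \<longrightarrow>
        curve_length G 0 1 (edge (F \<circ> simplex_map p) i j) =
          curve_length euclid_metric 0 1 (edge (simplex_map p) i j) \<and>
        curve_energy G 0 1 (edge (F \<circ> simplex_map p) i j) =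
          curve_energy euclid_metric 0 1 (edge (simplex_map p) i j)))
   \<and>
     geodesic_simplex M G (F \<circ> simplex_map p)
   \<and>
     (\<forall>\<xi>\<in>ref_simplex. \<exists>R. rotation_matrix R \<and>
        jacobian (F \<circ> simplex_map p) (at \<xi>) =
          matrix_inv_sqrt (G ((F \<circ> simplex_map p) \<xi>)) ** R ** jacobian (simplex_map p) (at \<xi>))
   \<and>
     ((\<forall>y\<in>linear_simplex p. distortion G F y \<ge> 1) \<and>
      (\<forall>y\<in>linear_simplex p. distortion G F y = 1))"
proof -
  interpret isometric_simplex \<Omega> M G F p
    using assms by unfold_locales
  show ?thesis
    using positively_oriented_physical vertex_angle_eq dihedral_angle_eq simplex_area_eq
      curve_length_eq curve_energy_eq geodesic_simplex_physical jacobian_eq_inv_sqrt_rotation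
      distortion_eq_1
    by (simp add: valid_Pq_simplex_def)
qed

end
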